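(* Let $\varphi:(\mathbb{R}^n)^\kappa\to\mathbb{R}^1$ be a continuous proper convex function, let $F(\cdot,t):(\mathbb{R}^n)^\kappa\rightrightarrows\mathbb{R}^n$ ($t\in[0,1]$) be a convex set-valued mapping, and let $Q_j\subseteq\mathbb{R}^n$, $j=0,\dots,\kappa-1$, be convex sets. Consider the problem $(P_H)$: minimize $\varphi\big(x(1),x'(1),\dots,x^{(\kappa-1)}(1)\big)$ over feasible trajectories $x(\cdot)$, i.e. subject to $$x^{(\kappa)}(t)\in F\big(x(t),x'(t),\dots,x^{(\kappa-1)}(t),t\big)\ \text{ a.e. } t\in[0,1],\qquad x^{(j)}(0)\in Q_j,\ j=0,\dots,\kappa-1.$$ Then for the optimality of a feasible trajectory $\tilde x(\cdot)$ in $(P_H)$ it is sufficient that there exist absolutely continuous functions $x^*(t),\ \eta_j^*(t)$, $j=1,\dots,\kappa-1$, $t\in[0,1]$ (with the regularity specified in the context), such that: (i) for a.e. $t\in[0,1]$, $$\Big((-1)^\kappa x^{*(\kappa)}(t)+\eta_{\kappa-1}^{*\prime}(t),\ \eta_{\kappa-1}^*(t)+\eta_{\kappa-2}^{*\prime}(t),\ \dots,\ \eta_2^*(t)+\eta_1^{*\prime}(t),\ \eta_1^*(t)\Big)\in F^*\big(x^*(t);(\tilde x(t),\tilde x'(t),\dots,\tilde x^{(\kappa)}(t)),t\big);$$ (ii) $(-1)^{j+1}x^{*(j)}(0)+\eta_j^*(0)\in K^*_{Q_{\kappa-j-1}}\big(\tilde x^{(\kappa-j-1)}(0)\big)$ for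 $j=1,\dots,\kappa-1$, and $-x^*(0)\in K^*_{Q_{\kappa-1}}\big(\tilde x^{(\kappa-1)}(0)\big)$; (iii) $\Big((-1)^\kappa x^{*(\kappa-1)}(1)+\eta_{\kappa-1}^*(1),\ (-1)^{\kappa-1}x^{*(\kappa-2)}(1)+\eta_{\kappa-2}^*(1),\ \dots,\ x^{*\prime}(1)+\eta_1^*(1),\ -x^*(1)\Big)\in\partial\varphi\big(\tilde x(1),\tilde x'(1),\dots,\tilde x^{(\kappa-1)}(1)\big)$; (iv) $\tilde x^{(\kappa)}(t)\in F_A\big(\tilde x(t),\tilde x'(t),\dots,\tilde x^{(\kappa-1)}(t);x^*(t),t\big)$ for a.e. $t\in[0,1]$.
   Context: $\kappa\ge1$ is a fixed natural number. A feasible trajectory is an $x:[0,1]\to\mathbb{R}^n$ that is absolutely continuous together with its derivatives up to order $\kappa-1$, with $x^{(\kappa)}\in L_1^n([0,1])$, satisfying the inclusion a.e. and the initial constraints. It is optimal if it minimizes the cost among feasible trajectories. The adjoint function $x^*:[0,1]\to\mathbb{R}^n$ is absolutely continuous together with its derivatives up to order $\kappa-1$, with $x^{*(\kappa)}\in L_1^n([0,1])$; each $\eta_j^*:[0,1]\to\mathbb{R}^n$ is absolutely continuous with $\eta_j^{*\prime}\in L_1^n([0,1])$. Convention: $\eta_0^*\equiv0$ (when $\kappa=1$ the tuple in (i) is just $-x^{*\prime}(t)$ and the tuple in (iii) is just $-x^*(1)$). A set-valued mapping $F:(\mathbb{R}^n)^\kappa\rightrightarrows\mathbb{R}^n$ is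 convex if $\operatorname{gph}F=\{(x,v_1,\dots,v_{\kappa-1},v):v\in F(x,v_1,\dots,v_{\kappa-1})\}$ is convex. For a convex set $A$ and $z\in A$, $K_A(z)=\operatorname{cone}(A-z)=\{\lambda(z_1-z):z_1\in A,\lambda>0\}$, and $K_A^*(z)=\{z^*:\langle \bar z,z^*\rangle\ge0\ \forall\bar z\in K_A(z)\}$ is its dual cone. The locally adjoint mapping (LAM) of convex $F$ at $z=(x,v_1,\dots,v_{\kappa-1},v)\in\operatorname{gph}F$ is $$F^*(v^*;z)=\{(x^*,v_1^*,\dots,v_{\kappa-1}^* ):(x^*,v_1^*,\dots,v_{\kappa-1}^*,-v^* )\in K^*_{\operatorname{gph}F}(z)\};$$ $F^*(\cdot;\cdot,t)$ denotes the LAM of $F(\cdot,t)$. The Hamiltonian is $H_F(x,v_1,\dots,v_{\kappa-1},v^* )=\sup\{\langle v,v^*\rangle:v\in F(x,v_1,\dots,v_{\kappa-1})\}$ and the argmaximum set is $F_A(x,v_1,\dots,v_{\kappa-1};v^* )=\{v\in F(x,v_1,\dots,v_{\kappa-1}):\langle v,v^*\rangle=H_F(x,v_1,\dots,v_{\kappa-1},v^* )\}$; $F_A(\cdot;\cdot,t)$ is that of $F(\cdot,t)$. $\partial\varphi$ is the subdifferential of convex analysis. *)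

theory Defs
  imports "HOL-Analysis.Analysis"
begin

text \<open>
  The space of \<open>\<kappa>\<close>-tuples of vectors of \<open>\<real>\<^sup>n\<close> is the type \<open>real^'n^'k\<close> with \<open>\<kappa> = CARD('k)\<close>.
  The components are numbered \<open>0, \<dots>, \<kappa> - 1\<close> along the linear order of \<open>'k\<close>, and
  \<open>tuple f\<close> is \<open>(f 0, \<dots>, f (\<kappa> - 1))\<close>.
\<close>

definition pos :: "'k::{finite,linorder} \<Rightarrow> nat" where
  "pos i = card {j. j < i}"

definition tuple :: "(nat \<Rightarrow> 'a) \<Rightarrow> 'a^'k::{finite,linorder}" where
  "tuple f = (\<chi> i. f (pos i))"

lemma pos_bij_betw: "bij_betw pos (UNIV :: 'k::{finite,linorder} set) {..<CARD('k)}"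
proof -
  have mono: "pos i < pos j" if "i < j" for i j :: 'k
    unfolding pos_def by (rule psubset_card_mono) (use that in auto)
  have inj: "inj (pos :: 'k \<Rightarrow> nat)"
    by (rule injI) (metis mono less_irrefl linorder_neqE)
  have "pos i < CARD('k)" for i :: 'k
    unfolding pos_def by (rule psubset_card_mono) auto
  then have "range (pos :: 'k \<Rightarrow> nat) \<subseteq> {..<CARD('k)}" by auto
  then have "range (pos :: 'k \<Rightarrow> nat) = {..<CARD('k)}"
    by (intro card_subset_eq) (simp_all add: card_image inj)
  then show ?thesis using inj by (simp add: bij_betw_def)
qed

section \<open>Convex analysis\<close>

definition gph :: "('a \<Rightarrow> 'b set) \<Rightarrow> ('a \<times> 'b) set" where
  "gph F = {(z, v). v \<in> F z}"

definition convex_setvalued :: "('a::real_vector \<Rightarrow> 'b::real_vector set) \<Rightarrow> bool" where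
  "convex_setvalued F \<longleftrightarrow> convex (gph F)"

definition cone_at :: "'a::real_vector set \<Rightarrow> 'a \<Rightarrow> 'a set" where
  "cone_at A z = {c *\<^sub>R (z1 - z) | c z1. z1 \<in> A \<and> c > 0}"

definition dual_cone_at :: "'a::real_inner set \<Rightarrow> 'a \<Rightarrow> 'a set" where
  "dual_cone_at A z = {w. \<forall>zb \<in> cone_at A z. zb \<bullet> w \<ge> 0}"

definition LAM :: "('a::real_inner \<Rightarrow> 'b::real_inner set) \<Rightarrow> 'b \<Rightarrow> 'a \<times> 'b \<Rightarrow> 'a set" where
  "LAM F vs z = {w. (w, - vs) \<in> dual_cone_at (gph F) z}"

text \<open>The supremum is extended-real valued: it is \<open>\<infinity>\<close> when unbounded and \<open>-\<infinity>\<close> on an empty image.\<close>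

definition hamiltonian :: "('a \<Rightarrow> 'b::real_inner set) \<Rightarrow> 'a \<Rightarrow> 'b \<Rightarrow> ereal" where
  "hamiltonian F z vs = (SUP v \<in> F z. ereal (v \<bullet> vs))"

definition argmax_set :: "('a \<Rightarrow> 'b::real_inner set) \<Rightarrow> 'a \<Rightarrow> 'b \<Rightarrow> 'b set" where
  "argmax_set F z vs = {v \<in> F z. ereal (v \<bullet> vs) = hamiltonian F z vs}"

definition subdiff :: "('a::real_inner \<Rightarrow> real) \<Rightarrow> 'a \<Rightarrow> 'a set" where
  "subdiff \<phi> z = {p. \<forall>y. \<phi> y - \<phi> z \<ge> p \<bullet> (y - z)}"

section \<open>Absolute continuity and trajectories\<close>

text \<open>
  The usual \<open>\<epsilon>\<close>-\<open>\<delta>\<close> condition: a division is a finite set of nonoverlapping nonempty closed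
  intervals \<open>I = {Inf I..Sup I}\<close>, whose union \<open>T\<close> need not fill \<open>S\<close>.
\<close>

definition abs_cont_on :: "real set \<Rightarrow> (real \<Rightarrow> 'a::real_normed_vector) \<Rightarrow> bool" where
  "abs_cont_on S f \<longleftrightarrow>
     (\<forall>\<epsilon>>0. \<exists>\<delta>>0. \<forall>d T. d division_of T \<and> T \<subseteq> S \<and> (\<Sum>I\<in>d. Sup I - Inf I) < \<delta> \<longrightarrow>
        (\<Sum>I\<in>d. norm (f (Sup I) - f (Inf I))) < \<epsilon>)"

text \<open>
  The \<open>m\<close>-th derivative on \<open>[0,1]\<close>, one-sided at the end points; values of \<open>x\<close> outside \<open>[0,1]\<close>
  are irrelevant. The value is unspecified where the derivative does not exist.
\<close>

definition D :: "nat \<Rightarrow> (real \<Rightarrow> 'a::real_normed_vector) \<Rightarrow> real \<Rightarrow> 'a" where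
  "D m x = ((\<lambda>g t. vector_derivative g (at t within {0..1})) ^^ m) x"

text \<open>
  For \<open>m \<ge> 1\<close>, \<open>AC_upto m x\<close> says that \<open>x, x', \<dots>, x\<^bsup>(m-1)\<^esup>\<close> exist everywhere on \<open>[0,1]\<close> and are absolutely
  continuous, and that \<open>x\<^bsup>(m)\<^esup>\<close> exists a.e. and is in \<open>L\<^sub>1\<close>. In finite dimension the a.e. existence
  follows from absolute continuity; it is listed because \<open>D m x\<close> is meaningful only with it.
\<close>

definition AC_upto :: "nat \<Rightarrow> (real \<Rightarrow> 'a::euclidean_space) \<Rightarrow> bool" where
  "AC_upto m x \<longleftrightarrow>
     (\<forall>j<m. abs_cont_on {0..1} (D j x)) \<and>
     (\<forall>j. Suc j < m \<longrightarrow> (\<forall>t\<in>{0..1}. D j x differentiable (at t within {0..1}))) \<and>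
     (AE t in lebesgue_on {0..1}. D (m - 1) x differentiable (at t within {0..1})) \<and>
     D m x absolutely_integrable_on {0..1}"

definition jet :: "(real \<Rightarrow> real^'n) \<Rightarrow> real \<Rightarrow> real^'n^'k::{finite,linorder}" where
  "jet x t = tuple (\<lambda>j. D j x t)"

definition feasible ::
  "(real^'n^'k::{finite,linorder} \<Rightarrow> real \<Rightarrow> (real^'n) set) \<Rightarrow> (nat \<Rightarrow> (real^'n) set) \<Rightarrow>
    (real \<Rightarrow> real^'n) \<Rightarrow> bool" where
  "feasible F Q x \<longleftrightarrow>
     AC_upto CARD('k) x \<and>
     (AE t in lebesgue_on {0..1}. D CARD('k) x t \<in> F (jet x t) t) \<and>
     (\<forall>j<CARD('k). D j x 0 \<in> Q j)"

definition optimal ::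
  "(real^'n^'k::{finite,linorder} \<Rightarrow> real) \<Rightarrow> (real^'n^'k::{finite,linorder} \<Rightarrow> real \<Rightarrow> (real^'n) set) \<Rightarrow>
    (nat \<Rightarrow> (real^'n) set) \<Rightarrow> (real \<Rightarrow> real^'n) \<Rightarrow> bool" where
  "optimal \<phi> F Q x \<longleftrightarrow>
     feasible F Q x \<and> (\<forall>y. feasible F Q y \<longrightarrow> \<phi> (jet x 1) \<le> \<phi> (jet y 1))"

end

theory Submission
  imports Defs
begin

text \<open>
  The proof is weak duality, with no integral in it. For a feasible competitor \<open>y\<close> put
  \<open>z\<^sub>i = y\<^bsup>(i)\<^esup> - x\<^bsup>(i)\<^esup>\<close> and pair these deviations with the multipliers
  \<open>p\<^sub>i = (-1)\<^bsup>\<kappa>-i\<^esup> x\<^sup>*\<^bsup>(\<kappa>-1-i)\<^esup> + \<eta>\<^sup>*\<^sub>\<kappa>\<^sub>-\<^sub>1\<^sub>-\<^sub>i\<close>, forming \<open>G(t) = \<Sum>\<^sub>i p\<^sub>i(t) \<bullet> z\<^sub>i(t)\<close>.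
  The vectors \<open>p\<^sub>i\<close> are chosen so that conditions (ii) and (iii) are statements about \<open>p(0)\<close> and
  \<open>p(1)\<close>: the first gives \<open>G(0) \<ge> 0\<close>, because \<open>z\<^sub>i(0) \<in> Q\<^sub>i - x\<^bsup>(i)\<^esup>(0)\<close>, and the second, which is
  the subgradient inequality, gives \<open>\<phi>(jet y 1) - \<phi>(jet x 1) \<ge> G(1)\<close>.

  It remains to see \<open>G(0) \<le> G(1)\<close>. In the product rule for \<open>G\<close> the terms telescope
  (\<open>adjoint_telescope\<close>), and \<open>G'(t)\<close> is precisely the pairing of the element
  \<open>(w, -x\<^sup>*(t))\<close> of the dual cone in (i) with the direction from the point of the graph given by
  \<open>x\<close> to the one given by \<open>y\<close>, which is nonnegative. So \<open>G' \<ge> 0\<close> almost everywhere, and \<open>G\<close> is absolutely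
  continuous; \<open>abs_cont_on_deriv_nonneg_imp_le\<close> says that such a function does not decrease.
\<close>

section \<open>Absolutely continuous functions\<close>

lemma division_interval_mem:
  fixes d :: "real set set"
  assumes "d division_of T" "I \<in> d"
  shows "Inf I \<in> T" "Sup I \<in> T" "Inf I \<le> Sup I" "I = {Inf I..Sup I}"
proof -
  obtain a b where ab: "I = cbox a b" "I \<noteq> {}" "I \<subseteq> T"
    using division_ofD(2,3,4)[OF assms(1)] assms(2) by metis
  then have "a \<le> b" by simp
  with ab show "Inf I \<in> T" "Sup I \<in> T" "Inf I \<le> Sup I" "I = {Inf I..Sup I}" by auto
qed

lemma abs_cont_onE:
  assumes "abs_cont_on S f" "e > 0"
  obtains \<delta> where "\<delta> > 0" "\<And>d T. d division_of T \<Longrightarrow> T \<subseteq> S \<Longrightarrow> (\<Sum>I\<in>d. Sup I - Inf I) < \<delta> \<Longrightarrow>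
      (\<Sum>I\<in>d. norm (f (Sup I) - f (Inf I))) < e"
proof -
  from assms(1)[unfolded abs_cont_on_def, rule_format, OF assms(2)] obtain \<delta> where
    "\<delta> > 0 \<and> (\<forall>d T. d division_of T \<and> T \<subseteq> S \<and> (\<Sum>I\<in>d. Sup I - Inf I) < \<delta> \<longrightarrow>
      (\<Sum>I\<in>d. norm (f (Sup I) - f (Inf I))) < e)" ..
  with that show thesis by meson
qed

lemma abs_cont_on_const: "abs_cont_on S (\<lambda>_. c)"
  unfolding abs_cont_on_def by (auto intro: exI[of _ 1])

text \<open>
  All closure properties come from this domination principle, in which the increments of the new
  function are controlled by those of two known ones.
\<close>

lemma abs_cont_on_dominated:
  fixes f :: "real \<Rightarrow> 'a::real_normed_vector" and g :: "real \<Rightarrow> 'b::real_normed_vector"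
    and h :: "real \<Rightarrow> 'c::real_normed_vector"
  assumes f: "abs_cont_on S f" and g: "abs_cont_on S g"
    and le: "\<And>u v. u \<in> S \<Longrightarrow> v \<in> S \<Longrightarrow>
      norm (h v - h u) \<le> C * (norm (f v - f u) + norm (g v - g u))"
  shows "abs_cont_on S h"
  unfolding abs_cont_on_def
proof (intro allI impI)
  fix e :: real assume e: "e > 0"
  define e' where "e' = e / (2 * (\<bar>C\<bar> + 1))"
  have e': "e' > 0" using e by (simp add: e'_def add_nonneg_pos)
  obtain d1 where d1: "d1 > 0" "\<And>d T. d division_of T \<Longrightarrow> T \<subseteq> S \<Longrightarrow> (\<Sum>I\<in>d. Sup I - Inf I) < d1 \<Longrightarrow>
      (\<Sum>I\<in>d. norm (f (Sup I) - f (Inf I))) < e'"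
    using abs_cont_onE[OF f e'] by blast
  obtain d2 where d2: "d2 > 0" "\<And>d T. d division_of T \<Longrightarrow> T \<subseteq> S \<Longrightarrow> (\<Sum>I\<in>d. Sup I - Inf I) < d2 \<Longrightarrow>
      (\<Sum>I\<in>d. norm (g (Sup I) - g (Inf I))) < e'"
    using abs_cont_onE[OF g e'] by blast
  show "\<exists>\<delta>>0. \<forall>d T. d division_of T \<and> T \<subseteq> S \<and> (\<Sum>I\<in>d. Sup I - Inf I) < \<delta> \<longrightarrow>
      (\<Sum>I\<in>d. norm (h (Sup I) - h (Inf I))) < e"
  proof (intro exI[of _ "min d1 d2"] conjI allI impI)
    show "min d1 d2 > 0" using d1(1) d2(1) by simp
    fix d T assume A: "d division_of T \<and> T \<subseteq> S \<and> (\<Sum>I\<in>d. Sup I - Inf I) < min d1 d2"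
    have "(\<Sum>I\<in>d. norm (h (Sup I) - h (Inf I)))
        \<le> (\<Sum>I\<in>d. (\<bar>C\<bar> + 1) * (norm (f (Sup I) - f (Inf I)) + norm (g (Sup I) - g (Inf I))))"
    proof (rule sum_mono)
      fix I assume "I \<in> d"
      with A have "Inf I \<in> S" "Sup I \<in> S"
        using division_interval_mem(1,2)[of d T I] by auto
      then have "norm (h (Sup I) - h (Inf I))
          \<le> C * (norm (f (Sup I) - f (Inf I)) + norm (g (Sup I) - g (Inf I)))" by (rule le)
      also have "\<dots> \<le> (\<bar>C\<bar> + 1) * (norm (f (Sup I) - f (Inf I)) + norm (g (Sup I) - g (Inf I)))"
        by (intro mult_right_mono) auto
      finally show "norm (h (Sup I) - h (Inf I)) \<le> \<dots>" .
    qed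
    also have "\<dots> = (\<bar>C\<bar> + 1) * ((\<Sum>I\<in>d. norm (f (Sup I) - f (Inf I)))
        + (\<Sum>I\<in>d. norm (g (Sup I) - g (Inf I))))"
      by (simp only: sum_distrib_left[symmetric] sum.distrib)
    also have "\<dots> < (\<bar>C\<bar> + 1) * (e' + e')"
      using A d1(2) d2(2) by (intro mult_strict_left_mono add_strict_mono) auto
    also have "\<dots> = e" by (simp add: e'_def field_simps add_nonneg_eq_0_iff)
    finally show "(\<Sum>I\<in>d. norm (h (Sup I) - h (Inf I))) < e" .
  qed
qed

lemma abs_cont_on_add:
  assumes "abs_cont_on S f" "abs_cont_on S g"
  shows "abs_cont_on S (\<lambda>t. f t + g t)"
  using assms
proof (rule abs_cont_on_dominated[where C = 1])
  fix u v
  show "norm (f v + g v - (f u + g u)) \<le> 1 * (norm (f v - f u) + norm (g v - g u))"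
    using norm_triangle_ineq[of "f v - f u" "g v - g u"] by (simp add: algebra_simps)
qed

lemma abs_cont_on_scaleR:
  assumes "abs_cont_on S f"
  shows "abs_cont_on S (\<lambda>t. c *\<^sub>R f t)"
proof (rule abs_cont_on_dominated[OF assms assms, where C = "\<bar>c\<bar>"])
  fix u v
  show "norm (c *\<^sub>R f v - c *\<^sub>R f u) \<le> \<bar>c\<bar> * (norm (f v - f u) + norm (f v - f u))"
    unfolding scaleR_diff_right[symmetric] norm_scaleR by (intro mult_left_mono) auto
qed

lemma abs_cont_on_diff:
  assumes "abs_cont_on S f" "abs_cont_on S g"
  shows "abs_cont_on S (\<lambda>t. f t - g t)"
  using abs_cont_on_add[OF assms(1) abs_cont_on_scaleR[OF assms(2), of "-1"]] by simp

lemma abs_cont_on_sum: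
  assumes "\<And>i. i \<in> A \<Longrightarrow> abs_cont_on S (f i)"
  shows "abs_cont_on S (\<lambda>t. \<Sum>i\<in>A. f i t)"
  using assms by (induction A rule: infinite_finite_induct)
    (auto intro: abs_cont_on_const abs_cont_on_add)

text \<open>Divisions with one interval turn absolute continuity into uniform continuity.\<close>

lemma abs_cont_on_imp_continuous_on:
  assumes f: "abs_cont_on {a..b} f"
  shows "continuous_on {a..b} f"
  unfolding continuous_on_iff
proof (intro ballI allI impI)
  fix s e :: real assume s: "s \<in> {a..b}" and e: "e > 0"
  obtain \<delta> where \<delta>: "\<delta> > 0" "\<And>d T. d division_of T \<Longrightarrow> T \<subseteq> {a..b} \<Longrightarrow>
      (\<Sum>I\<in>d. Sup I - Inf I) < \<delta> \<Longrightarrow> (\<Sum>I\<in>d. norm (f (Sup I) - f (Inf I))) < e"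
    using abs_cont_onE[OF f e] by blast
  have step: "norm (f v - f u) < e" if "u \<in> {a..b}" "v \<in> {a..b}" "u \<le> v" "v - u < \<delta>" for u v
    using \<delta>(2)[of "{cbox u v}" "cbox u v"] that division_of_self[of u v] by auto
  show "\<exists>d>0. \<forall>t\<in>{a..b}. dist t s < d \<longrightarrow> dist (f t) (f s) < e"
  proof (intro exI[of _ \<delta>] conjI ballI impI)
    fix t assume t: "t \<in> {a..b}" "dist t s < \<delta>"
    show "dist (f t) (f s) < e"
      using step[of s t] step[of t s] s t
      by (cases "s \<le> t") (auto simp: dist_norm norm_minus_commute)
  qed (rule \<delta>(1))
qed

lemma abs_cont_on_inner:
  fixes f g :: "real \<Rightarrow> 'a::real_inner"
  assumes f: "abs_cont_on {a..b} f" and g: "abs_cont_on {a..b} g"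
  shows "abs_cont_on {a..b} (\<lambda>t. f t \<bullet> g t)"
proof -
  have bdd: "bounded (f ` {a..b})" "bounded (g ` {a..b})"
    using f g by (auto intro!: compact_imp_bounded compact_continuous_image abs_cont_on_imp_continuous_on)
  then obtain A B where A: "\<And>t. t \<in> {a..b} \<Longrightarrow> norm (f t) \<le> A" and B: "\<And>t. t \<in> {a..b} \<Longrightarrow> norm (g t) \<le> B"
    unfolding bounded_iff by (metis image_eqI)
  show ?thesis
  proof (rule abs_cont_on_dominated[OF f g, where C = "max A B"])
    fix u v assume uv: "u \<in> {a..b}" "v \<in> {a..b}"
    have "norm (f v \<bullet> g v - f u \<bullet> g u) = norm ((f v - f u) \<bullet> g v + f u \<bullet> (g v - g u))"
      by (simp add: inner_diff)
    also have "\<dots> \<le> norm (f v - f u) * norm (g v) + norm (f u) * norm (g v - g u)"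
      by (rule order_trans[OF norm_triangle_ineq]) (simp add: Cauchy_Schwarz_ineq2 add_mono)
    also have "\<dots> \<le> norm (f v - f u) * max A B + max A B * norm (g v - g u)"
      using A[OF uv(1)] B[OF uv(2)] by (intro add_mono mult_left_mono mult_right_mono) auto
    finally show "norm (f v \<bullet> g v - f u \<bullet> g u) \<le> max A B * (norm (f v - f u) + norm (g v - g u))"
      by (simp add: algebra_simps)
  qed
qed

section \<open>Monotonicity from the sign of the derivative\<close>

text \<open>
  Because \<open>t\<close> lies between \<open>u\<close> and \<open>v\<close>, the errors of the linear approximation at \<open>u\<close> and at \<open>v\<close>
  add up to at most \<open>e * (v - u)\<close>. So the loss over \<open>{u..v}\<close> is controlled by its length, which is the
  form that can be summed over a division.
\<close>

lemma has_real_derivative_nonneg_straddle: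
  fixes G :: "real \<Rightarrow> real"
  assumes "(G has_real_derivative g) (at t within S)" "g \<ge> 0" "e > 0"
  shows "\<exists>d>0. \<forall>u\<in>S. \<forall>v\<in>S. u \<le> t \<longrightarrow> t \<le> v \<longrightarrow> u \<in> ball t d \<longrightarrow> v \<in> ball t d \<longrightarrow>
    G v - G u \<ge> - e * (v - u)"
proof -
  obtain d where d: "d > 0"
    "\<And>y. y \<in> S \<Longrightarrow> norm (y - t) < d \<Longrightarrow> norm (G y - G t - g * (y - t)) \<le> e * norm (y - t)"
    using assms(1,3) unfolding has_field_derivative_def has_derivative_within_alt by metis
  show ?thesis
  proof (intro exI[of _ d] conjI ballI impI)
    fix u v assume *: "u \<in> S" "v \<in> S" "u \<le> t" "t \<le> v" "u \<in> ball t d" "v \<in> ball t d"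
    have "\<bar>G u - G t - g * (u - t)\<bar> \<le> e * (t - u)" "\<bar>G v - G t - g * (v - t)\<bar> \<le> e * (v - t)"
      using d(2)[of u] d(2)[of v] * by (auto simp: dist_real_def)
    moreover have "g * (u - t) \<le> 0" "g * (v - t) \<ge> 0"
      using * assms(2) by (auto simp: mult_nonneg_nonpos)
    ultimately show "G v - G u \<ge> - e * (v - u)" by (simp add: algebra_simps)
  qed (rule d(1))
qed

text \<open>
  The gauge treats the two kinds of tags differently. Where the derivative exists and is
  nonnegative, an interval loses at most \<open>e\<close> times its length. The other tags form a null set, and
  their intervals are forced into an open set so small that absolute continuity bounds their joint
  contribution by \<open>e\<close>.
\<close>

lemma abs_cont_on_deriv_nonneg_imp_le:
  fixes G :: "real \<Rightarrow> real"
  assumes G: "abs_cont_on {a..b} G" and ab: "a \<le> b"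
    and deriv: "AE t in lebesgue_on {a..b}. \<exists>g\<ge>0. (G has_real_derivative g) (at t within {a..b})"
  shows "G a \<le> G b"
proof (rule field_le_epsilon)
  fix e0 :: real assume e0: "e0 > 0"
  \<comment> \<open>the two kinds of tags lose \<open>e * (b - a)\<close> and \<open>e\<close>\<close>
  define e where "e = e0 / (b - a + 1)"
  have e: "e > 0" and e_eq: "e * (b - a) + e = e0"
  proof -
    have "e * (b - a) + e = e * (b - a + 1)" by (simp add: algebra_simps)
    with e0 ab show "e > 0" "e * (b - a) + e = e0" by (simp_all add: e_def)
  qed
  obtain \<delta> where \<delta>: "\<delta> > 0" "\<And>d T. d division_of T \<Longrightarrow> T \<subseteq> {a..b} \<Longrightarrow>
      (\<Sum>I\<in>d. Sup I - Inf I) < \<delta> \<Longrightarrow> (\<Sum>I\<in>d. norm (G (Sup I) - G (Inf I))) < e"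
    using abs_cont_onE[OF G e] by blast
  have "AE t in lebesgue. t \<in> {a..b} \<longrightarrow> (\<exists>g\<ge>0. (G has_real_derivative g) (at t within {a..b}))"
    using deriv by (simp add: AE_restrict_space_iff)
  then obtain N where N: "N \<in> null_sets lebesgue"
    "\<And>t. t \<in> {a..b} \<Longrightarrow> t \<notin> N \<Longrightarrow> \<exists>g\<ge>0. (G has_real_derivative g) (at t within {a..b})"
    by (rule AE_E3) simp
  obtain U where U: "open U" "N \<subseteq> U" "U \<in> lmeasurable" "measure lebesgue U < \<delta>"
  proof -
    have "N \<in> sets lebesgue" using N(1) by (rule null_setsD2)
    then obtain U where *: "open U" "N \<subseteq> U" "emeasure lebesgue (U - N) < ennreal \<delta>"
      by (rule sets_lebesgue_outer_open[OF _ \<delta>(1)])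
    have "U \<in> sets lebesgue" using *(1) by simp
    then have less: "emeasure lebesgue U < ennreal \<delta>"
      using *(3) emeasure_Diff_null_set[OF N(1)] by simp
    with \<open>U \<in> sets lebesgue\<close> have U: "U \<in> lmeasurable"
      by (auto intro!: fmeasurableI intro: less_trans)
    have "measure lebesgue U < \<delta>"
      using U less \<delta>(1) by (simp add: emeasure_eq_measure2 ennreal_less_iff)
    then show thesis by (rule that[OF *(1,2) U])
  qed
  have "\<exists>d>0. \<forall>u\<in>{a..b}. \<forall>v\<in>{a..b}. u \<le> t \<longrightarrow> t \<le> v \<longrightarrow> u \<in> ball t d \<longrightarrow> v \<in> ball t d \<longrightarrow>
      G v - G u \<ge> - e * (v - u)" if "t \<in> {a..b}" "t \<notin> N" for t
    using N(2)[OF that] has_real_derivative_nonneg_straddle e by blast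
  then obtain r where r: "\<And>t. t \<in> {a..b} \<Longrightarrow> t \<notin> N \<Longrightarrow> r t > 0"
    "\<And>t u v. t \<in> {a..b} \<Longrightarrow> t \<notin> N \<Longrightarrow> u \<in> {a..b} \<Longrightarrow> v \<in> {a..b} \<Longrightarrow> u \<le> t \<Longrightarrow> t \<le> v \<Longrightarrow>
      u \<in> ball t (r t) \<Longrightarrow> v \<in> ball t (r t) \<Longrightarrow> G v - G u \<ge> - e * (v - u)"
    by metis
  define \<gamma> where "\<gamma> t = (if t \<in> N then U else if t \<in> {a..b} then ball t (r t) else ball t 1)" for t
  have "gauge \<gamma>"
    unfolding gauge_def \<gamma>_def using U r(1) by auto
  then obtain p where p: "p tagged_division_of {a..b}" and fine: "\<gamma> fine p"
    by (rule fine_division_exists_real)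
  have fin: "finite p" using p by blast
  have pD: "t \<in> K" "Inf K \<le> t" "t \<le> Sup K" "{Inf K, Sup K} \<subseteq> \<gamma> t" "{t, Inf K, Sup K} \<subseteq> {a..b}"
    if tK: "(t, K) \<in> p" for t K
  proof -
    obtain u v where uv: "K = cbox u v" using tK p by blast
    have t: "t \<in> K" "K \<subseteq> {a..b}" using tK p by blast+
    have "K \<subseteq> \<gamma> t" using fine tK by (auto simp: fine_def)
    with t uv show "t \<in> K" "Inf K \<le> t" "t \<le> Sup K" "{Inf K, Sup K} \<subseteq> \<gamma> t" "{t, Inf K, Sup K} \<subseteq> {a..b}"
      by auto
  qed
  define B where "B = {(t, K) \<in> p. t \<in> N}"
  have B: "B tagged_partial_division_of {a..b}"
    using p by (auto simp: B_def tagged_division_of_def intro: tagged_partial_division_subset)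
  have Bdiv: "snd ` B division_of \<Union>(snd ` B)"
    by (rule partial_division_of_tagged_division[OF B])
  \<comment> \<open>Summing over tags or over intervals is the same for functions vanishing on degenerate
    intervals; the default \<open>0\<close> covers the empty interval, whose \<open>Inf\<close> and \<open>Sup\<close> are unspecified.\<close>
  have B_sum: "(\<Sum>(t, K)\<in>B. \<bar>G (Sup K) - G (Inf K)\<bar>) = (\<Sum>K\<in>snd ` B. \<bar>G (Sup K) - G (Inf K)\<bar>)"
  proof -
    let ?h = "\<lambda>K. if K = {} then 0 else \<bar>G (Sup K) - G (Inf K)\<bar>"
    have "(\<Sum>(t, K)\<in>B. ?h K) = (\<Sum>K\<in>snd ` B. ?h K)"
    proof (rule sum.over_tagged_division_lemma[OF tagged_partial_division_of_Union_self[OF B]])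
      fix u v :: real assume "box u v = {}"
      then show "?h (cbox u v) = 0" by (cases "u = v") auto
    qed
    moreover have "(\<Sum>(t, K)\<in>B. ?h K) = (\<Sum>(t, K)\<in>B. \<bar>G (Sup K) - G (Inf K)\<bar>)"
      by (intro sum.cong refl) (auto simp: B_def dest: pD(1))
    moreover have "(\<Sum>K\<in>snd ` B. ?h K) = (\<Sum>K\<in>snd ` B. \<bar>G (Sup K) - G (Inf K)\<bar>)"
      using Bdiv by (intro sum.cong) auto
    ultimately show ?thesis by simp
  qed
  have len: "(\<Sum>K\<in>snd ` B. Sup K - Inf K) < \<delta>"
  proof -
    have "(\<Sum>K\<in>snd ` B. Sup K - Inf K) = (\<Sum>K\<in>snd ` B. measure lebesgue K)"
    proof (intro sum.cong refl)
      fix K assume K: "K \<in> snd ` B"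
      have "measure lebesgue {Inf K..Sup K} = Sup K - Inf K"
        using division_interval_mem(3)[OF Bdiv K] by simp
      then show "Sup K - Inf K = measure lebesgue K"
        by (simp only: division_interval_mem(4)[OF Bdiv K, symmetric])
    qed
    also have "\<dots> = measure lebesgue (\<Union>(snd ` B))"
      by (rule content_division[OF Bdiv])
    also have "\<dots> \<le> measure lebesgue U"
    proof (rule measure_mono_fmeasurable[OF _ _ U(3)])
      show "\<Union>(snd ` B) \<subseteq> U"
        using fine by (fastforce simp: B_def fine_def \<gamma>_def)
      show "\<Union>(snd ` B) \<in> sets lebesgue"
        using lmeasurable_division[OF Bdiv] by (rule fmeasurableD)
    qed
    finally show ?thesis using U(4) by simp
  qed
  have bad: "(\<Sum>(t, K)\<in>B. G (Sup K) - G (Inf K)) \<ge> - e"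
  proof -
    have "\<Union>(snd ` B) \<subseteq> {a..b}"
      using tagged_division_ofD(3)[OF p] by (fastforce simp: B_def)
    then have "(\<Sum>K\<in>snd ` B. \<bar>G (Sup K) - G (Inf K)\<bar>) < e"
      using \<delta>(2)[OF Bdiv _ len] by simp
    moreover have "\<bar>\<Sum>(t, K)\<in>B. G (Sup K) - G (Inf K)\<bar> \<le> (\<Sum>(t, K)\<in>B. \<bar>G (Sup K) - G (Inf K)\<bar>)"
      by (rule order_trans[OF sum_abs]) (simp add: case_prod_unfold)
    ultimately show ?thesis using B_sum by linarith
  qed
  have good: "(\<Sum>(t, K)\<in>p - B. G (Sup K) - G (Inf K)) \<ge> - (e * (b - a))"
  proof -
    have len_p: "(\<Sum>(t, K)\<in>p. Sup K - Inf K) = b - a"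
      using additive_tagged_division_1[OF ab p, of "\<lambda>t. t"] by simp
    have "0 \<le> Sup K - Inf K" if "(t, K) \<in> p" for t K
      using pD(2,3)[OF that] by simp
    then have "(\<Sum>(t, K)\<in>p - B. Sup K - Inf K) \<le> (\<Sum>(t, K)\<in>p. Sup K - Inf K)"
      by (intro sum_mono2[OF fin Diff_subset]) auto
    then have "- (e * (b - a)) \<le> - e * (\<Sum>(t, K)\<in>p - B. Sup K - Inf K)"
      using e len_p by simp
    also have "\<dots> = (\<Sum>(t, K)\<in>p - B. - e * (Sup K - Inf K))"
      by (simp add: sum_distrib_left case_prod_unfold)
    also have "\<dots> \<le> (\<Sum>(t, K)\<in>p - B. G (Sup K) - G (Inf K))"
    proof (rule sum_mono, clarify)
      fix t K assume tK: "(t, K) \<in> p" "(t, K) \<notin> B"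
      then have "t \<notin> N" by (simp add: B_def)
      moreover have "t \<in> {a..b}" using pD(5)[OF tK(1)] by simp
      ultimately have "\<gamma> t = ball t (r t)" by (simp add: \<gamma>_def)
      with pD[OF tK(1)] \<open>t \<notin> N\<close> show "- e * (Sup K - Inf K) \<le> G (Sup K) - G (Inf K)"
        by (intro r(2)[of t]) auto
    qed
    finally show ?thesis .
  qed
  have "G b - G a = (\<Sum>(t, K)\<in>p. G (Sup K) - G (Inf K))"
    using additive_tagged_division_1[OF ab p, of G] by simp
  also have "\<dots> = (\<Sum>(t, K)\<in>p - B. G (Sup K) - G (Inf K)) + (\<Sum>(t, K)\<in>B. G (Sup K) - G (Inf K))"
    using fin by (intro sum.subset_diff) (auto simp: B_def)
  finally show "G a \<le> G b + e0" using bad good e_eq by linarith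
qed

section \<open>Trajectories and tuples\<close>

lemma D_0 [simp]: "D 0 x = x"
  by (simp add: D_def)

lemma AC_upto_abs_cont_on: "AC_upto m x \<Longrightarrow> j < m \<Longrightarrow> abs_cont_on {0..1} (D j x)"
  by (simp add: AC_upto_def)

lemma AC_upto_has_vector_derivative:
  assumes "AC_upto m x" "j < m"
  shows "AE t in lebesgue_on {0..1}. (D j x has_vector_derivative D (Suc j) x t) (at t within {0..1})"
proof -
  have D_Suc: "D (Suc j) x t = vector_derivative (D j x) (at t within {0..1})" for t
    by (simp add: D_def)
  have "AE t in lebesgue_on {0..1}. D j x differentiable (at t within {0..1})"
  proof (cases "Suc j < m")
    case True
    with assms(1) show ?thesis by (intro AE_I2) (auto simp: AC_upto_def)
  next
    case False
    with assms(2) have "j = m - 1" by simp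
    with assms(1) show ?thesis by (simp add: AC_upto_def)
  qed
  then show ?thesis by (simp add: D_Suc vector_derivative_works)
qed

lemma AC_upto_const: "AC_upto 1 (\<lambda>_. c)"
proof -
  have "D 1 (\<lambda>_. c) t = 0" if "t \<in> {0..1}" for t
    using that vector_derivative_within_closed_interval[of 0 1 t "\<lambda>_. c" 0] by (simp add: D_def)
  then have "D 1 (\<lambda>_. c) absolutely_integrable_on {0..1}"
    using absolutely_integrable_spike_eq[of "{}" "{0..1}" "D 1 (\<lambda>_. c)" "\<lambda>_. 0"] by simp
  then show ?thesis by (simp add: AC_upto_def abs_cont_on_const)
qed

lemma inner_tuple:
  fixes f g :: "nat \<Rightarrow> 'a::real_inner"
  shows "(tuple f :: 'a^'k::{finite,linorder}) \<bullet> tuple g = (\<Sum>i<CARD('k). f i \<bullet> g i)"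
  unfolding inner_vec_def tuple_def
  using sum.reindex_bij_betw[OF pos_bij_betw, of "\<lambda>i. f i \<bullet> g i"] by simp

lemma jet_diff: "jet y t - jet x t = tuple (\<lambda>i. D i y t - D i x t)"
  by (simp add: jet_def tuple_def vec_eq_iff)

lemma dual_cone_atD: "w \<in> dual_cone_at A z \<Longrightarrow> z1 \<in> A \<Longrightarrow> w \<bullet> (z1 - z) \<ge> 0"
  by (force simp: dual_cone_at_def cone_at_def inner_commute intro: exI[of _ 1])

section \<open>The duality pairing\<close>

text \<open>
  Here \<open>X j\<close>, \<open>E j\<close>, \<open>E' j\<close> and \<open>z i\<close> are the values at one instant of \<open>x\<^sup>*\<^bsup>(j)\<^esup>\<close>, \<open>\<eta>\<^sup>*\<^sub>j\<close>, its derivative,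
  and the \<open>i\<close>-th derivative of the deviation. The left side is the product rule for the pairing.
  Since consecutive signs alternate, the term \<open>X (\<kappa> - i)\<close> in \<open>p\<^sub>i\<^sub>-\<^sub>1 \<bullet> z\<^sub>i\<close> cancels the one in \<open>p\<^sub>i' \<bullet> z\<^sub>i\<close>;
  what survives is the adjoint expression and the last boundary term.
\<close>

lemma adjoint_telescope:
  fixes X E E' z :: "nat \<Rightarrow> 'a::real_inner"
  assumes "\<kappa> > 0" "E 0 = 0"
  shows "(\<Sum>i<\<kappa>. ((-1)^(\<kappa>-i) *\<^sub>R X (\<kappa>-1-i) + E (\<kappa>-1-i)) \<bullet> z (Suc i)
           + ((-1)^(\<kappa>-i) *\<^sub>R X (\<kappa>-i) + E' (\<kappa>-1-i)) \<bullet> z i)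
       = (\<Sum>i<\<kappa>. (if i = 0 then (-1)^\<kappa> *\<^sub>R X \<kappa> + E' (\<kappa>-1) else E (\<kappa>-i) + E' (\<kappa>-1-i)) \<bullet> z i)
           - X 0 \<bullet> z \<kappa>"
proof -
  obtain m where m: "\<kappa> = Suc m" using assms(1) by (cases \<kappa>) auto
  define p where "p i = (-1)^(\<kappa>-i) *\<^sub>R X (\<kappa>-1-i) + E (\<kappa>-1-i)" for i
  define q where "q i = (-1)^(\<kappa>-i) *\<^sub>R X (\<kappa>-i) + E' (\<kappa>-1-i)" for i
  define w where "w i = (if i = 0 then (-1)^\<kappa> *\<^sub>R X \<kappa> + E' (\<kappa>-1) else E (\<kappa>-i) + E' (\<kappa>-1-i))" for i
  have w0: "w 0 = q 0" by (simp add: w_def q_def)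
  have wSuc: "w (Suc i) = q (Suc i) + p i" if "i < m" for i
  proof -
    have "\<kappa> - i = Suc (\<kappa> - Suc i)" using that m by simp
    then show ?thesis by (simp add: w_def q_def p_def)
  qed
  have pm: "p m = - X 0" using assms(2) by (simp add: p_def m)
  have "(\<Sum>i<\<kappa>. p i \<bullet> z (Suc i) + q i \<bullet> z i) = (\<Sum>i<\<kappa>. p i \<bullet> z (Suc i)) + (\<Sum>i<\<kappa>. q i \<bullet> z i)"
    by (rule sum.distrib)
  also have "(\<Sum>i<\<kappa>. q i \<bullet> z i) = q 0 \<bullet> z 0 + (\<Sum>i<m. q (Suc i) \<bullet> z (Suc i))"
    unfolding m by (rule sum.lessThan_Suc_shift)
  also have "(\<Sum>i<\<kappa>. p i \<bullet> z (Suc i)) = (\<Sum>i<m. p i \<bullet> z (Suc i)) + p m \<bullet> z (Suc m)"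
    unfolding m by (rule sum.lessThan_Suc)
  also have "(\<Sum>i<m. p i \<bullet> z (Suc i)) + p m \<bullet> z (Suc m) + (q 0 \<bullet> z 0 + (\<Sum>i<m. q (Suc i) \<bullet> z (Suc i)))
      = w 0 \<bullet> z 0 + (\<Sum>i<m. w (Suc i) \<bullet> z (Suc i)) - X 0 \<bullet> z \<kappa>"
  proof -
    have "(\<Sum>i<m. w (Suc i) \<bullet> z (Suc i)) = (\<Sum>i<m. q (Suc i) \<bullet> z (Suc i) + p i \<bullet> z (Suc i))"
      by (intro sum.cong refl) (simp add: wSuc inner_add_left)
    then show ?thesis by (simp add: w0 pm m sum.distrib)
  qed
  also have "w 0 \<bullet> z 0 + (\<Sum>i<m. w (Suc i) \<bullet> z (Suc i)) = (\<Sum>i<\<kappa>. w i \<bullet> z i)"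
    unfolding m by (simp only: sum.lessThan_Suc_shift)
  finally show ?thesis unfolding p_def q_def w_def .
qed

text \<open>
  The function \<open>\<eta> 0\<close> is identically \<open>0\<close>, so it is absolutely continuous with derivative \<open>0\<close>. Hence the
  initial condition on \<open>xs\<close> is the case \<open>j = 0\<close> of the conditions for \<open>j \<ge> 1\<close>, and reindexing by
  \<open>i = \<kappa> - 1 - j\<close> makes (ii) the statement that \<open>p\<^sub>i(0)\<close> lies in the dual cone of \<open>Q i\<close>.
\<close>

theorem theorem3p1:
  fixes \<phi> :: "real^'n^'k::{finite,linorder} \<Rightarrow> real"
    and F :: "real^'n^'k::{finite,linorder} \<Rightarrow> real \<Rightarrow> (real^'n) set"
    and Q :: "nat \<Rightarrow> (real^'n) set"
    and x :: "real \<Rightarrow> real^'n"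
    and \<kappa> :: nat
  assumes kappa: "\<kappa> = CARD('k)"
    and phi_cont: "continuous_on UNIV \<phi>"
    and phi_convex: "convex_on UNIV \<phi>"
    and F_convex: "\<And>t. t \<in> {0..1} \<Longrightarrow> convex_setvalued (\<lambda>z. F z t)"
    and Q_convex: "\<And>j. j < \<kappa> \<Longrightarrow> convex (Q j)"
    and x_feasible: "feasible F Q x"
    and adjoint: "\<exists>(xs :: real \<Rightarrow> real^'n) (\<eta> :: nat \<Rightarrow> real \<Rightarrow> real^'n).
      AC_upto \<kappa> xs \<and>
      (\<forall>j\<in>{1..\<kappa>-1}. AC_upto 1 (\<eta> j)) \<and>
      (\<forall>t. \<eta> 0 t = 0) \<and>
      \<comment> \<open>(i)\<close>
      (AE t in lebesgue_on {0..1}.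
         tuple (\<lambda>i. if i = 0 then (-1)^\<kappa> *\<^sub>R D \<kappa> xs t + D 1 (\<eta> (\<kappa>-1)) t
                    else \<eta> (\<kappa>-i) t + D 1 (\<eta> (\<kappa>-1-i)) t)
         \<in> LAM (\<lambda>z. F z t) (xs t) (jet x t, D \<kappa> x t)) \<and>
      \<comment> \<open>(ii)\<close>
      (\<forall>j\<in>{1..\<kappa>-1}. (-1)^(j+1) *\<^sub>R D j xs 0 + \<eta> j 0
         \<in> dual_cone_at (Q (\<kappa>-j-1)) (D (\<kappa>-j-1) x 0)) \<and>
      - xs 0 \<in> dual_cone_at (Q (\<kappa>-1)) (D (\<kappa>-1) x 0) \<and>
      \<comment> \<open>(iii)\<close>
      tuple (\<lambda>i. (-1)^(\<kappa>-i) *\<^sub>R D (\<kappa>-1-i) xs 1 + \<eta> (\<kappa>-1-i) 1) \<in> subdiff \<phi> (jet x 1) \<and>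
      \<comment> \<open>(iv)\<close>
      (AE t in lebesgue_on {0..1}. D \<kappa> x t \<in> argmax_set (\<lambda>z. F z t) (jet x t) (xs t))"
  shows "optimal \<phi> F Q x"
proof -
  have \<kappa>_pos: "\<kappa> > 0" using kappa by simp
  obtain xs :: "real \<Rightarrow> real^'n" and \<eta> :: "nat \<Rightarrow> real \<Rightarrow> real^'n" where
    xs: "AC_upto \<kappa> xs" and \<eta>_pos: "\<forall>j\<in>{1..\<kappa>-1}. AC_upto 1 (\<eta> j)" and \<eta>0: "\<forall>t. \<eta> 0 t = 0" and
    inclusion: "AE t in lebesgue_on {0..1}.
         tuple (\<lambda>i. if i = 0 then (-1)^\<kappa> *\<^sub>R D \<kappa> xs t + D 1 (\<eta> (\<kappa>-1)) t
                    else \<eta> (\<kappa>-i) t + D 1 (\<eta> (\<kappa>-1-i)) t)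
         \<in> LAM (\<lambda>z. F z t) (xs t) (jet x t, D \<kappa> x t)" and
    initial_pos: "\<forall>j\<in>{1..\<kappa>-1}. (-1)^(j+1) *\<^sub>R D j xs 0 + \<eta> j 0
         \<in> dual_cone_at (Q (\<kappa>-j-1)) (D (\<kappa>-j-1) x 0)" and
    initial0: "- xs 0 \<in> dual_cone_at (Q (\<kappa>-1)) (D (\<kappa>-1) x 0)" and
    terminal: "tuple (\<lambda>i. (-1)^(\<kappa>-i) *\<^sub>R D (\<kappa>-1-i) xs 1 + \<eta> (\<kappa>-1-i) 1) \<in> subdiff \<phi> (jet x 1)"
    using adjoint by blast
  have "\<eta> 0 = (\<lambda>_. 0)" using \<eta>0 by auto
  then have \<eta>: "AC_upto 1 (\<eta> j)" if "j < \<kappa>" for j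
    using \<eta>_pos that AC_upto_const by (cases "j = 0") auto
  have initial: "(-1)^(\<kappa>-i) *\<^sub>R D (\<kappa>-1-i) xs 0 + \<eta> (\<kappa>-1-i) 0 \<in> dual_cone_at (Q i) (D i x 0)"
    if "i < \<kappa>" for i
  proof (cases "i = \<kappa> - 1")
    case True
    with initial0 \<eta>0 \<kappa>_pos show ?thesis by simp
  next
    case False
    with that have "\<kappa> - 1 - i \<in> {1..\<kappa>-1}" "\<kappa> - 1 - i + 1 = \<kappa> - i" "\<kappa> - (\<kappa> - 1 - i) - 1 = i" by auto
    with initial_pos show ?thesis by metis
  qed
  have x: "AC_upto \<kappa> x"
    using x_feasible by (simp add: feasible_def kappa)
  have "\<phi> (jet x 1) \<le> \<phi> (jet y 1)" if feas: "feasible F Q y" for y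
  proof -
    have y: "AC_upto \<kappa> y" "\<And>j. j < \<kappa> \<Longrightarrow> D j y 0 \<in> Q j"
      "AE t in lebesgue_on {0..1}. D \<kappa> y t \<in> F (jet y t) t"
      using feas by (auto simp: feasible_def kappa)
    define z where "z i t = D i y t - D i x t" for i t
    define p where "p i t = (-1)^(\<kappa>-i) *\<^sub>R D (\<kappa>-1-i) xs t + \<eta> (\<kappa>-1-i) t" for i t
    define p' where "p' i t = (-1)^(\<kappa>-i) *\<^sub>R D (\<kappa>-i) xs t + D 1 (\<eta> (\<kappa>-1-i)) t" for i t
    define G where "G t = (\<Sum>i<\<kappa>. p i t \<bullet> z i t)" for t
    have "abs_cont_on {0..1} G"
      unfolding G_def
    proof (intro abs_cont_on_sum abs_cont_on_inner)
      fix i assume i: "i \<in> {..<\<kappa>}"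
      show "abs_cont_on {0..1} (z i)"
        unfolding z_def using i x y(1) by (intro abs_cont_on_diff AC_upto_abs_cont_on) auto
      have "abs_cont_on {0..1} (\<eta> (\<kappa>-1-i))"
        using AC_upto_abs_cont_on[OF \<eta>, of "\<kappa>-1-i" 0] \<kappa>_pos by simp
      then show "abs_cont_on {0..1} (p i)"
        unfolding p_def using xs i \<kappa>_pos
        by (intro abs_cont_on_add abs_cont_on_scaleR AC_upto_abs_cont_on) auto
    qed
    moreover have "AE t in lebesgue_on {0..1}. \<exists>g\<ge>0. (G has_real_derivative g) (at t within {0..1})"
    proof -
      have dz: "AE t in lebesgue_on {0..1}. \<forall>i\<in>{..<\<kappa>}.
          (z i has_vector_derivative z (Suc i) t) (at t within {0..1})"
      proof (rule AE_finite_allI)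
        fix i assume "i \<in> {..<\<kappa>}"
        then have "i < \<kappa>" by simp
        from AC_upto_has_vector_derivative[OF x this] AC_upto_has_vector_derivative[OF y(1) this]
        show "AE t in lebesgue_on {0..1}. (z i has_vector_derivative z (Suc i) t) (at t within {0..1})"
          unfolding z_def by eventually_elim (rule has_vector_derivative_diff)
      qed simp
      have dp: "AE t in lebesgue_on {0..1}. \<forall>i\<in>{..<\<kappa>}.
          (p i has_vector_derivative p' i t) (at t within {0..1})"
      proof (rule AE_finite_allI)
        fix i assume "i \<in> {..<\<kappa>}"
        then have i: "\<kappa>-1-i < \<kappa>" "Suc (\<kappa>-1-i) = \<kappa>-i" by auto
        from AC_upto_has_vector_derivative[OF xs i(1)]
          AC_upto_has_vector_derivative[OF \<eta>[OF i(1)] zero_less_one]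
        show "AE t in lebesgue_on {0..1}. (p i has_vector_derivative p' i t) (at t within {0..1})"
        proof eventually_elim
          case (elim t)
          then show ?case
            unfolding p_def p'_def i(2)
            by (auto intro!: has_vector_derivative_add
                bounded_linear.has_vector_derivative[OF bounded_linear_scaleR_right])
        qed
      qed simp
      show ?thesis
        using dz dp inclusion y(3)
      proof eventually_elim
        case (elim t)
        define w where "w = (\<lambda>i. if i = 0 then (-1)^\<kappa> *\<^sub>R D \<kappa> xs t + D 1 (\<eta> (\<kappa>-1)) t
                    else \<eta> (\<kappa>-i) t + D 1 (\<eta> (\<kappa>-1-i)) t)"
        let ?g = "\<Sum>i<\<kappa>. p i t \<bullet> z (Suc i) t + p' i t \<bullet> z i t"
        have "(G has_vector_derivative ?g) (at t within {0..1})"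
          unfolding G_def using elim(1,2)
          by (intro has_vector_derivative_sum bounded_bilinear.has_vector_derivative[OF bounded_bilinear_inner]) auto
        then have "(G has_real_derivative ?g) (at t within {0..1})"
          by (simp add: has_real_derivative_iff_has_vector_derivative)
        moreover have "?g \<ge> 0"
        proof -
          have "(tuple w, - xs t) \<in> dual_cone_at (gph (\<lambda>z. F z t)) (jet x t, D \<kappa> x t)"
            using elim(3) by (simp add: LAM_def w_def)
          moreover have "(jet y t, D \<kappa> y t) \<in> gph (\<lambda>z. F z t)"
            using elim(4) by (simp add: gph_def)
          ultimately have "0 \<le> (tuple w :: real^'n^'k::{finite,linorder}, - xs t) \<bullet> ((jet y t, D \<kappa> y t) - (jet x t, D \<kappa> x t))"
            by (rule dual_cone_atD)
          also have "\<dots> = (\<Sum>i<\<kappa>. w i \<bullet> z i t) - xs t \<bullet> z \<kappa> t"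
            by (simp add: jet_diff inner_tuple kappa z_def)
          also have "\<dots> = ?g"
            using adjoint_telescope[of \<kappa> "\<lambda>j. \<eta> j t" "\<lambda>j. D j xs t" "\<lambda>i. z i t" "\<lambda>j. D 1 (\<eta> j) t"]
              \<kappa>_pos \<eta>0 by (simp add: p_def p'_def w_def)
          finally show ?thesis .
        qed
        ultimately show ?case by blast
      qed
    qed
    ultimately have mono: "G 0 \<le> G 1"
      by (rule abs_cont_on_deriv_nonneg_imp_le[OF _ zero_le_one])
    have "G 0 \<ge> 0"
      unfolding G_def z_def p_def using initial y(2) by (intro sum_nonneg) (auto intro: dual_cone_atD)
    moreover have "\<phi> (jet y 1) - \<phi> (jet x 1) \<ge> G 1"
    proof -
      have "\<phi> (jet y 1) - \<phi> (jet x 1) \<ge> (tuple (\<lambda>i. p i 1) :: real^'n^'k::{finite,linorder}) \<bullet> (jet y 1 - jet x 1)"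
        using terminal by (simp add: subdiff_def p_def)
      then show ?thesis by (simp add: jet_diff inner_tuple kappa G_def z_def)
    qed
    ultimately show ?thesis using mono by linarith
  qed
  with x_feasible show ?thesis by (simp add: optimal_def)
qed

end
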